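(* For every odd prime power $q\notin\{5,7\}$ there exists an orthomorphism $\phi\in\mathscr{D}_{(q-1)/2}(q)$.
   Context: Let $\mathbb{F}_q$ be the finite field of order $q$. An orthomorphism is a permutation $\theta$ of $\mathbb{F}_q$ such that $x\mapsto\theta(x)-x$ is also a permutation. For $k\mid(q-1)$, fix a generator $g$ of $\mathbb{F}_q^*$ and let $C_{k,i}=\{g^j: j\equiv i\pmod k\}$, $0\le i<k$ (cyclotomy classes of index $k$). A cyclotomic map of index $k$ with multipliers $[a_0,\dots,a_{k-1}]$ is $\theta(0)=0$, $\theta(x)=a_ix$ for $x\in C_{k,i}$. $\mathscr{C}_k(q)$ is the set of orthomorphisms that are cyclotomic maps of index $k$, and $\mathscr{D}_k(q)=\mathscr{C}_k(q)\setminus\bigcup_{\ell<k,\ \ell\mid(q-1)}\mathscr{C}_\ell(q)$ (orthomorphisms of least index $k$). *)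

theory Defs
  imports "HOL-Number_Theory.Cong" "HOL-Number_Theory.Prime_Powers" "HOL-Library.Cardinality"
begin

definition orthomorphism :: "('a::field \<Rightarrow> 'a) \<Rightarrow> bool" where
  "orthomorphism \<theta> \<longleftrightarrow> bij \<theta> \<and> bij (\<lambda>x. \<theta> x - x)"

definition mult_generator :: "'a::field \<Rightarrow> bool" where
  "mult_generator g \<longleftrightarrow> range (\<lambda>j::nat. g ^ j) = UNIV - {0}"

text \<open>Natural exponents suffice: the field is finite and \<open>k\<close> divides the order of \<open>g\<close>.\<close>

definition cyclotomy_class :: "'a::{field,finite} \<Rightarrow> nat \<Rightarrow> nat \<Rightarrow> 'a set" where
  "cyclotomy_class g k i = {g ^ j | j :: nat. [j = i] (mod k)}"

definition cyclotomic_map ::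
  "'a::{field,finite} \<Rightarrow> nat \<Rightarrow> (nat \<Rightarrow> 'a) \<Rightarrow> ('a \<Rightarrow> 'a) \<Rightarrow> bool" where
  "cyclotomic_map g k a \<theta> \<longleftrightarrow>
     k dvd CARD('a) - 1 \<and> \<theta> 0 = 0 \<and> (\<forall>i<k. \<forall>x\<in>cyclotomy_class g k i. \<theta> x = a i * x)"

definition cyclotomic_orthomorphisms :: "'a::{field,finite} \<Rightarrow> nat \<Rightarrow> ('a \<Rightarrow> 'a) set" where
  "cyclotomic_orthomorphisms g k = {\<theta>. orthomorphism \<theta> \<and> (\<exists>a. cyclotomic_map g k a \<theta>)}"

definition least_index_orthomorphisms :: "'a::{field,finite} \<Rightarrow> nat \<Rightarrow> ('a \<Rightarrow> 'a) set" where
  "least_index_orthomorphisms g k =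
     cyclotomic_orthomorphisms g k -
       (\<Union>l\<in>{l. l < k \<and> l dvd CARD('a) - 1}. cyclotomic_orthomorphisms g l)"

end

(* A cyclotomic map has index (q - 1) / 2 iff it is odd, and a smaller index l makes it commute
   with multiplication by h = g^l, where h^2 is not 1. We look for orthomorphisms 2x + s(x) with s
   odd; commuting with h then means s(hx) = h s(x), so h maps values of s to values of s.

   If q is not prime, let s be 1 on a coset c + F_p not contained in F_p, -1 on its negative, and 0
   elsewhere: h = h s(c) is then a value of s, hence 1 or -1.

   If q = 4m + L is prime with L in {1, 3}, let x + s(x) exchange, up to sign, a block of m
   consecutive integers in (0, q / 2) with the adjacent block of length L, and fix the remaining
   integers in (0, q / 2). The nonzero values of s are L, D and their negatives, where 2D = L or
   2D = -L in F_q. As h is not 1 or -1, it must exchange L and D up to sign, which forces 5 = 0.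
   This leaves q = 3, where s = 0 works, and q = 11, where an explicit s vanishes only at 0, 1
   and -1. *)

theory Submission
  imports Defs "HOL-Number_Theory.Residues"
begin

section \<open>Order of a generator and the least-index criterion\<close>

text \<open>If \<open>g ^ d = 1\<close> with \<open>d > 0\<close>, at most \<open>d\<close> distinct
  powers occur, so \<open>d\<close> is at least q - 1. Pigeonhole on the exponents 0, ..., q - 1
  yields such a \<open>d\<close> that is at most q - 1.\<close>

lemma generator_power_card:
  fixes g :: "'a::{field,finite}"
  assumes "mult_generator g"
  shows "g ^ (CARD('a) - 1) = 1"
    and "\<And>d. 0 < d \<Longrightarrow> d < CARD('a) - 1 \<Longrightarrow> g ^ d \<noteq> 1"
proof -
  let ?N = "CARD('a) - 1"
  have range: "range (\<lambda>j::nat. g ^ j) = UNIV - {0}"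
    using assms by (simp add: mult_generator_def)
  have card: "card (range (\<lambda>j::nat. g ^ j)) = ?N"
    unfolding range by (simp add: card_Diff_singleton)
  have "g ^ 1 \<in> UNIV - {0}" using range by blast
  then have g0: "g \<noteq> 0" by simp
  have small: "?N \<le> d" if "0 < d" "g ^ d = 1" for d
  proof -
    have "g ^ j = g ^ (j mod d)" for j
    proof -
      have "g ^ j = g ^ (d * (j div d) + j mod d)" by simp
      also have "\<dots> = g ^ (j mod d)" unfolding power_add power_mult that(2) by simp
      finally show ?thesis .
    qed
    then have "range (\<lambda>j::nat. g ^ j) \<subseteq> (\<lambda>j. g ^ j) ` {..<d}"
      using that(1) by (metis image_eqI image_subsetI lessThan_iff mod_less_divisor)
    then have "card (range (\<lambda>j::nat. g ^ j)) \<le> card ((\<lambda>j. g ^ j) ` {..<d})"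
      by (intro card_mono) auto
    also have "\<dots> \<le> d" using card_image_le[of "{..<d}" "\<lambda>j. g ^ j"] by simp
    finally show ?thesis by (simp add: card)
  qed
  show "\<And>d. 0 < d \<Longrightarrow> d < ?N \<Longrightarrow> g ^ d \<noteq> 1"
    using small by (metis not_le)
  have "\<not> inj_on (\<lambda>j. g ^ j) {..?N}"
  proof
    assume "inj_on (\<lambda>j. g ^ j) {..?N}"
    then have "card ((\<lambda>j. g ^ j) ` {..?N}) = Suc ?N" by (simp add: card_image)
    moreover have "card ((\<lambda>j. g ^ j) ` {..?N}) \<le> card (range (\<lambda>j::nat. g ^ j))"
      by (intro card_mono) auto
    ultimately show False by (simp add: card)
  qed
  then obtain i j where ij: "i < j" "j \<le> ?N" "g ^ i = g ^ j"
    by (metis atMost_iff linorder_inj_onI')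
  have "g ^ j = g ^ i * g ^ (j - i)" using ij(1) power_add[of g i "j - i"] by simp
  then have *: "g ^ (j - i) = 1" using ij g0 by simp
  then have "?N \<le> j - i" using small[of "j - i"] ij by simp
  then have "j - i = ?N" using ij by simp
  then show "g ^ ?N = 1" using * by simp
qed

text \<open>Since \<open>g ^ k = - 1\<close> for k = (q - 1)/2, each class of index k is a pair {x,
  -x}, on which an odd map has a single multiplier. For a smaller divisor \<open>l\<close>, both x
  and \<open>g ^ l * x\<close> lie in one class of index \<open>l\<close>, so \<open>asym\<close>
  with \<open>h = g ^ l\<close> rules \<open>l\<close> out.\<close>

lemma least_index_orthomorphismI:
  fixes g :: "'a::{field,finite}" and \<theta> :: "'a \<Rightarrow> 'a"
  assumes g: "mult_generator g" and odd_card: "odd CARD('a)"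
    and orth: "orthomorphism \<theta>" and odd_fun: "\<And>x. \<theta> (- x) = - \<theta> x"
    and asym: "\<And>h. h \<noteq> 0 \<Longrightarrow> h\<^sup>2 \<noteq> 1 \<Longrightarrow> \<exists>x. \<theta> (h * x) \<noteq> h * \<theta> x"
    and two: "(2::'a) \<noteq> 0"
  shows "\<theta> \<in> least_index_orthomorphisms g ((CARD('a) - 1) div 2)"
proof -
  let ?N = "CARD('a) - 1"
  let ?k = "?N div 2"
  have "CARD('a) \<noteq> 0" by simp
  then have N: "?N = 2 * ?k" using odd_card by auto
  have "card {0, 1::'a} \<le> CARD('a)" by (intro card_mono) auto
  then have k: "0 < ?k" using N by auto
  have range: "range (\<lambda>j::nat. g ^ j) = UNIV - {0}"
    using g by (simp add: mult_generator_def)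
  have nz: "g ^ j \<noteq> 0" for j using range by blast
  have t0: "\<theta> 0 = 0"
  proof -
    have "2 * \<theta> 0 = 0" using odd_fun[of 0] by (metis add.right_inverse minus_zero mult_2)
    then show ?thesis using two by simp
  qed
  have "(g ^ ?k)\<^sup>2 = 1"
    using generator_power_card(1)[OF g] N by (metis mult.commute power_mult)
  moreover have "g ^ ?k \<noteq> 1" using generator_power_card(2)[OF g, of ?k] k N by linarith
  ultimately have gk: "g ^ ?k = - 1" by (simp add: power2_eq_1_iff)
  have "cyclotomic_map g ?k (\<lambda>i. \<theta> (g ^ i) / g ^ i) \<theta>"
    unfolding cyclotomic_map_def
  proof (intro conjI allI impI ballI)
    show "?k dvd ?N" using N by (metis dvd_triv_right)
    fix i x assume i: "i < ?k" and "x \<in> cyclotomy_class g ?k i"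
    then obtain j where x: "x = g ^ j" and "[j = i] (mod ?k)"
      by (auto simp: cyclotomy_class_def)
    then have "j mod ?k = i" using i by (simp add: cong_def)
    then have "j = ?k * (j div ?k) + i" by (metis mult_div_mod_eq)
    then have "x = (- 1) ^ (j div ?k) * g ^ i"
      using x gk by (metis power_add power_mult)
    then show "\<theta> x = \<theta> (g ^ i) / g ^ i * x"
      using nz[of i] odd_fun[of "g ^ i"] by (cases "even (j div ?k)") auto
  qed (rule t0)
  then have "\<theta> \<in> cyclotomic_orthomorphisms g ?k"
    using orth by (auto simp: cyclotomic_orthomorphisms_def)
  moreover have "\<theta> \<notin> cyclotomic_orthomorphisms g l" if l: "l < ?k" "l dvd ?N" for l
  proof
    assume "\<theta> \<in> cyclotomic_orthomorphisms g l"
    then obtain a where a: "\<And>i x. i < l \<Longrightarrow> x \<in> cyclotomy_class g l i \<Longrightarrow> \<theta> x = a i * x"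
      by (auto simp: cyclotomic_orthomorphisms_def cyclotomic_map_def)
    \<comment> \<open>Zero does not divide the positive number q - 1. Hence 0 < 2l < q - 1, and the
      square of \<open>g ^ l\<close> is not 1.\<close>
    have l0: "0 < l" using l N k by (intro Nat.gr0I) auto
    have "(g ^ l)\<^sup>2 \<noteq> 1"
      using generator_power_card(2)[OF g, of "l * 2"] l0 l N by (simp add: power_mult)
    then obtain x where x: "\<theta> (g ^ l * x) \<noteq> g ^ l * \<theta> x"
      using asym[of "g ^ l"] nz by blast
    then have "x \<noteq> 0" using t0 by auto
    then obtain j where j: "x = g ^ j" using range by blast
    have "x \<in> cyclotomy_class g l (j mod l)"
      unfolding cyclotomy_class_def j by (auto simp: cong_def)
    moreover have "g ^ l * x \<in> cyclotomy_class g l (j mod l)"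
      unfolding cyclotomy_class_def j
      by (auto simp: cong_def simp flip: power_add intro!: exI[of _ "l + j"])
    ultimately show False using a[of "j mod l"] l0 x by simp
  qed
  ultimately show ?thesis by (auto simp: least_index_orthomorphisms_def)
qed

lemma orthomorphism_finiteI:
  fixes \<theta> :: "'a::{field,finite} \<Rightarrow> 'a"
  assumes "inj \<theta> \<or> surj \<theta>" and "inj (\<lambda>x. \<theta> x - x) \<or> surj (\<lambda>x. \<theta> x - x)"
  shows "orthomorphism \<theta>"
proof -
  have "inj f \<longleftrightarrow> surj f" for f :: "'a \<Rightarrow> 'a"
    using finite_UNIV_inj_surj[OF _, of f] finite_UNIV_surj_inj[OF _, of f] by auto
  then show ?thesis using assms unfolding orthomorphism_def bij_def by metis
qed

section \<open>Fields larger than their prime field\<close>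

text \<open>The perturbation \<open>s\<close> has values in the prime field \<open>K\<close> and is
  constant on cosets of \<open>K\<close>. If 2x + s(x) or x + s(x) agrees at x and y, then x - y
  lies in \<open>K\<close>, so s(x) = s(y) and x = y.\<close>

lemma exists_of_proper_prime_field:
  fixes g c :: "'a::{field,finite}"
  assumes g: "mult_generator g" and odd_card: "odd CARD('a)" and two: "(2::'a) \<noteq> 0"
    and odd_char: "odd CHAR('a)" and c: "c \<notin> range of_int"
  shows "\<exists>\<phi>. \<phi> \<in> least_index_orthomorphisms g ((CARD('a) - 1) div 2)"
proof -
  define K :: "'a set" where "K = range of_int"
  have add: "x + y \<in> K" if "x \<in> K" "y \<in> K" for x y
    using that unfolding K_def by (metis (no_types) imageE of_int_add rangeI)
  have neg: "- x \<in> K \<longleftrightarrow> x \<in> K" for x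
    unfolding K_def by (metis (no_types) imageE minus_minus of_int_minus rangeI)
  have one: "1 \<in> K" unfolding K_def by (metis of_int_1 rangeI)
  have half: "x \<in> K" if x: "2 * x \<in> K" for x
  proof -
    obtain i where i: "2 * x = of_int i" using x unfolding K_def by blast
    \<comment> \<open>With p the characteristic, \<open>t\<close> = (p + 1)/2 is an integer
      representing the inverse of 2.\<close>
    have "even (CHAR('a) + 1)" using odd_char by simp
    then obtain t where t: "CHAR('a) + 1 = 2 * t" by (rule evenE)
    have "of_nat (CHAR('a) + 1) = (1::'a)" by simp
    then have "2 * of_nat t = (1::'a)" unfolding t by simp
    then have "x = of_int (int t * i)"
      using i by (metis mult.assoc mult.commute mult_1 of_int_mult of_int_of_nat_eq)
    then show ?thesis unfolding K_def by blast
  qed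
  have cK: "c \<notin> K" using c by (simp add: K_def)
  define s :: "'a \<Rightarrow> 'a" where "s x = (if x - c \<in> K then 1 else if x + c \<in> K then - 1 else 0)" for x
  \<comment> \<open>The cosets c + K and -c + K are disjoint, for otherwise 2c and then c would lie
    in \<open>K\<close>. This makes \<open>s\<close> odd.\<close>
  have excl: False if "x - c \<in> K" "x + c \<in> K" for x
  proof -
    have "(x + c) + - (x - c) \<in> K" using that add neg by blast
    then have "2 * c \<in> K" by simp
    then show False using half cK by blast
  qed
  have odd_s: "s (- x) = - s x" for x
  proof -
    have "- x - c \<in> K \<longleftrightarrow> x + c \<in> K" "- x + c \<in> K \<longleftrightarrow> x - c \<in> K"
      using neg[of "x + c"] neg[of "x - c"] by simp_all
    then show ?thesis using excl[of x] by (auto simp: s_def)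
  qed
  have sK: "s x \<in> K" for x using one neg[of 1] neg[of 0] add[of 1 "-1"] by (auto simp: s_def)
  have per: "s x = s y" if "x - y \<in> K" for x y
  proof -
    have "x - c \<in> K \<longleftrightarrow> y - c \<in> K"
      using add[OF that, of "y - c"] add[of "- (x - y)" "x - c"] neg[of "x - y"] that by auto
    moreover have "x + c \<in> K \<longleftrightarrow> y + c \<in> K"
      using add[OF that, of "y + c"] add[of "- (x - y)" "x + c"] neg[of "x - y"] that by auto
    ultimately show ?thesis by (simp add: s_def)
  qed
  have sdiff: "s y - s x \<in> K" for x y
    using add[of "s y" "- s x"] sK neg by simp
  let ?\<theta> = "\<lambda>x. 2 * x + s x"
  have "inj ?\<theta>"
  proof (rule injI)
    fix x y assume eq: "2 * x + s x = 2 * y + s y"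
    then have "2 * (x - y) = s y - s x" by (simp add: algebra_simps)
    then have "x - y \<in> K" using sdiff half by metis
    then have "s x = s y" by (rule per)
    then show "x = y" using eq two by simp
  qed
  moreover have "inj (\<lambda>x. ?\<theta> x - x)"
  proof (rule injI)
    fix x y assume "2 * x + s x - x = 2 * y + s y - y"
    then have eq: "x + s x = y + s y" by simp
    then have "x - y = s y - s x" by (simp add: algebra_simps)
    then have "x - y \<in> K" using sdiff by metis
    then have "s x = s y" by (rule per)
    then show "x = y" using eq by simp
  qed
  ultimately have "orthomorphism ?\<theta>" by (intro orthomorphism_finiteI) auto
  moreover have "\<exists>x. ?\<theta> (h * x) \<noteq> h * ?\<theta> x" if h: "h \<noteq> 0" "h\<^sup>2 \<noteq> 1" for h
  proof (rule exI[of _ c], rule notI)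
    assume "?\<theta> (h * c) = h * ?\<theta> c"
    then have "s (h * c) = h * s c" by (simp add: algebra_simps)
    moreover have "s c = 1" using neg[of 0] one add[of 1 "-1"] neg[of 1] by (simp add: s_def)
    ultimately have "s (h * c) = h" by simp
    then have "h \<in> {1, - 1, 0}" by (auto simp: s_def split: if_splits)
    then show False using h by auto
  qed
  ultimately have "?\<theta> \<in> least_index_orthomorphisms g ((CARD('a) - 1) div 2)"
    using g odd_card two odd_s by (intro least_index_orthomorphismI) auto
  then show ?thesis by blast
qed

section \<open>Prime fields: odd maps given by integers on 1, ..., n\<close>

text \<open>Here \<open>n\<close> = (p - 1)/2, so the nonzero elements are 1, ..., n and their
  negatives, without repetition. An odd map is thus determined by its values on 1, ..., n.\<close>

locale odd_prime_field =
  fixes n :: int and field_type :: "'a::{field,finite} itself"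
  assumes CHAR_eq: "int CHAR('a) = 2 * n + 1"
    and prime_field: "range of_int = (UNIV :: 'a set)"
begin

lemma of_int_eq_0_iff: "(of_int i :: 'a) = 0 \<longleftrightarrow> 2 * n + 1 dvd i"
  using of_int_eq_iff_cong_CHAR[of i 0, where ?'a = 'a] unfolding CHAR_eq cong_0_iff of_int_0 .

lemma rep:
  obtains j where "0 \<le> j" "j \<le> n" "x = (of_int j :: 'a) \<or> x = - of_int j"
proof -
  obtain i where i: "x = of_int i" using prime_field by (metis UNIV_I imageE)
  let ?j = "i mod (2 * n + 1)"
  have n: "0 < 2 * n + 1" using finite_imp_CHAR_pos[where ?'a = 'a] CHAR_eq by simp
  have xj: "x = of_int ?j"
    unfolding i of_int_eq_iff_cong_CHAR CHAR_eq by (simp add: cong_def)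
  have "x = - of_int (2 * n + 1 - ?j)"
    using xj of_int_eq_0_iff[of "2 * n + 1"] by simp
  moreover have "0 \<le> ?j" "?j < 2 * n + 1"
    using n by (rule pos_mod_sign, rule pos_mod_bound)
  ultimately show ?thesis
    using that[of ?j] that[of "2 * n + 1 - ?j"] xj by fastforce
qed

text \<open>For i, j in 1, ..., n the sum i + j lies strictly between 0 and 2n + 1, so no element is
  counted both as positive and as negative; values on the positive half extend consistently.\<close>

lemma odd_extension:
  fixes d :: "int \<Rightarrow> int"
  obtains s :: "'a \<Rightarrow> 'a" where "\<And>x. s (- x) = - s x" "s 0 = 0"
    "\<And>i. i \<in> {1..n} \<Longrightarrow> s (of_int i) = of_int (d i)"
proof -
  let ?P = "of_int ` {1..n} :: 'a set"
  have inj: "inj_on (of_int :: int \<Rightarrow> 'a) {1..n}"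
  proof (rule inj_onI)
    fix i j assume ij: "i \<in> {1..n}" "j \<in> {1..n}" "(of_int i :: 'a) = of_int j"
    then have "2 * n + 1 dvd i - j" using of_int_eq_0_iff[of "i - j"] by simp
    then show "i = j" using ij zdvd_imp_le[of "2 * n + 1" "\<bar>i - j\<bar>"] by force
  qed
  have excl: "- of_int i \<noteq> (of_int j :: 'a)" if "i \<in> {1..n}" "j \<in> {1..n}" for i j
  proof
    assume "- of_int i = (of_int j :: 'a)"
    then have "(of_int (i + j) :: 'a) = 0" by (metis add.right_inverse of_int_add)
    then have "2 * n + 1 dvd i + j" using of_int_eq_0_iff by blast
    then show False using that zdvd_imp_le[of "2 * n + 1" "i + j"] by simp
  qed
  define r :: "'a \<Rightarrow> int" where "r = inv_into {1..n} of_int"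
  have r: "r (of_int i) = i" if "i \<in> {1..n}" for i
    unfolding r_def using inv_into_f_f[OF inj that] .
  define s :: "'a \<Rightarrow> 'a" where
    "s x = (if x \<in> ?P then of_int (d (r x)) else if - x \<in> ?P then - of_int (d (r (- x))) else 0)" for x
  have "0 \<notin> ?P"
  proof
    assume "0 \<in> ?P"
    then obtain i where i: "i \<in> {1..n}" "(of_int i :: 'a) = 0" by force
    show False using excl[OF i(1) i(1)] i(2) by simp
  qed
  then have "s 0 = 0" by (simp add: s_def)
  moreover have "x \<notin> ?P \<or> - x \<notin> ?P" for x using excl by fastforce
  then have "s (- x) = - s x" for x unfolding s_def by auto
  moreover have "s (of_int i) = of_int (d i)" if "i \<in> {1..n}" for i
    using that r by (simp add: s_def)
  ultimately show ?thesis using that by blast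
qed

text \<open>Negating the argument corrects a wrong sign, so it suffices to reach each j in 1, ..., n
  up to sign.\<close>

lemma odd_surj:
  fixes f :: "'a \<Rightarrow> 'a" and d :: "int \<Rightarrow> int"
  assumes odd: "\<And>x. f (- x) = - f x" and f0: "f 0 = 0"
    and f: "\<And>i. i \<in> {1..n} \<Longrightarrow> f (of_int i) = of_int (d i)"
    and d: "\<And>j. j \<in> {1..n} \<Longrightarrow> \<exists>i\<in>{1..n}. 2 * n + 1 dvd d i - j \<or> 2 * n + 1 dvd d i + j"
  shows "surj f"
proof -
  have "y \<in> range f" for y
  proof -
    obtain j where j: "0 \<le> j" "j \<le> n" "y = of_int j \<or> y = - of_int j" using rep .
    have "\<exists>x. f x = of_int j \<or> f x = - of_int j"
    proof (cases "j = 0")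
      case True
      then show ?thesis using f0 by auto
    next
      case False
      then obtain i where i: "i \<in> {1..n}" "2 * n + 1 dvd d i - j \<or> 2 * n + 1 dvd d i + j"
        using d[of j] j by auto
      then have "(of_int (d i - j) :: 'a) = 0 \<or> (of_int (d i + j) :: 'a) = 0"
        using of_int_eq_0_iff by blast
      then have "f (of_int i) = of_int j \<or> f (of_int i) = - of_int j"
        using f[OF i(1)] by (auto simp: eq_neg_iff_add_eq_0)
      then show ?thesis by blast
    qed
    then obtain x where "f x = of_int j \<or> f x = - of_int j" ..
    then have "f x = y \<or> f (- x) = y" using j(3) odd by (metis minus_minus)
    then show ?thesis by blast
  qed
  then show ?thesis by blast
qed

text \<open>Reduces prime fields to integer data \<open>d\<close>: \<open>sigma\<close> makes x +
  s(x) surjective and \<open>theta\<close> makes 2x + s(x) surjective for the odd extension s of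
  \<open>d\<close>. The part 2x commutes with \<open>h\<close>, so \<open>asym\<close> only has to
  deal with s.\<close>

lemma exists_least_index:
  fixes d :: "int \<Rightarrow> int" and g :: 'a
  assumes g: "mult_generator g" and odd_card: "odd CARD('a)" and two: "(2::'a) \<noteq> 0"
    and sigma: "\<And>j. j \<in> {1..n} \<Longrightarrow>
      \<exists>i\<in>{1..n}. 2 * n + 1 dvd i + d i - j \<or> 2 * n + 1 dvd i + d i + j"
    and theta: "\<And>j. j \<in> {1..n} \<Longrightarrow>
      \<exists>i\<in>{1..n}. 2 * n + 1 dvd 2 * i + d i - j \<or> 2 * n + 1 dvd 2 * i + d i + j"
    and asym: "\<And>s h. (\<And>x. s (- x) = - s x) \<Longrightarrow> s 0 = 0 \<Longrightarrow>
      (\<And>i. i \<in> {1..n} \<Longrightarrow> s (of_int i) = of_int (d i)) \<Longrightarrow>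
      (\<And>x::'a. s (h * x) = h * s x) \<Longrightarrow> h \<noteq> 0 \<Longrightarrow> h\<^sup>2 = 1"
  shows "\<exists>\<phi>. \<phi> \<in> least_index_orthomorphisms g ((CARD('a) - 1) div 2)"
proof -
  obtain s :: "'a \<Rightarrow> 'a" where s: "\<And>x. s (- x) = - s x" "s 0 = 0"
    "\<And>i. i \<in> {1..n} \<Longrightarrow> s (of_int i) = of_int (d i)" using odd_extension[of d] by blast
  let ?\<theta> = "\<lambda>x. 2 * x + s x"
  have "surj ?\<theta>"
    by (rule odd_surj[where d = "\<lambda>i. 2 * i + d i"]) (use s theta in auto)
  moreover have "surj (\<lambda>x. ?\<theta> x - x)"
    by (rule odd_surj[where d = "\<lambda>i. i + d i"]) (use s sigma in auto)
  ultimately have "orthomorphism ?\<theta>" by (intro orthomorphism_finiteI) auto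
  moreover have "\<exists>x. ?\<theta> (h * x) \<noteq> h * ?\<theta> x" if h: "h \<noteq> 0" "h\<^sup>2 \<noteq> 1" for h
  proof (rule ccontr)
    assume "\<not> ?thesis"
    then have "2 * (h * x) + s (h * x) = h * (2 * x + s x)" for x by blast
    then have "s (h * x) = h * s x" for x
      by (metis add_left_cancel distrib_left mult.left_commute)
    then show False using asym[OF s] h by blast
  qed
  ultimately have "?\<theta> \<in> least_index_orthomorphisms g ((CARD('a) - 1) div 2)"
    using g odd_card two s(1) by (intro least_index_orthomorphismI) auto
  then show ?thesis by blast
qed

section \<open>The block exchange in prime fields\<close>

text \<open>The parity of \<open>m\<close> selects \<open>c\<close> so that \<open>D\<close> is 2m
  for even \<open>m\<close> and 2m + L for odd \<open>m\<close>. In either case 2D is -L or L modulo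
  2n + 1. The bound \<open>L < m\<close> keeps both blocks inside 1, ..., n.\<close>

lemma block_swap:
  fixes L m c :: int and g :: 'a
  assumes g: "mult_generator g" and odd_card: "odd CARD('a)" and two: "(2::'a) \<noteq> 0"
    and n: "2 * n + 1 = 4 * m + L" and L: "L = 1 \<or> L = 3" and Lm: "L < m" and c: "1 \<le> c"
    and mc: "even m \<and> 2 * c = m - L + 1 \<or> odd m \<and> 2 * c = m + 1"
  shows "\<exists>\<phi>. \<phi> \<in> least_index_orthomorphisms g ((CARD('a) - 1) div 2)"
proof -
  define D where "D = 2 * c + L - 1 + m"
  \<comment> \<open>The choice of \<open>c\<close> makes the multiples \<open>2 i\<close> of the moved \<open>i\<close> coincide, up to sign, with the
    values \<open>2 i + d i\<close>: the first block is reflected to \<open>2 m - i\<close> and the second fills the gap.\<close>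
  define d where "d i = (if i < c then 0 else if i < c + m then L
    else if i < c + m + L then - D else 0)" for i
  have end_le: "c + m + L - 1 \<le> n" using n L Lm mc by auto
  show ?thesis
  proof (rule exists_least_index[OF g odd_card two, of d])
    fix j assume j: "j \<in> {1..n}"
    \<comment> \<open>Preimages under \<open>i + d i\<close>, up to sign: the first block is shifted
      up by \<open>L\<close>. As \<open>D\<close> is the sum of the end points c and c + m + L - 1,
      i - D carries the second block to the negatives of c, ..., c + L - 1.\<close>
    define i where "i = (if j < c then j else if j < c + L then D - j
      else if j < c + m + L then j - L else j)"
    have "i \<in> {1..n}" using j end_le c L Lm by (auto simp: i_def D_def)
    moreover have "i + d i - j = 0 \<or> i + d i + j = 0"
      using j end_le c L Lm by (auto simp: i_def d_def D_def)
    ultimately show "\<exists>i\<in>{1..n}. 2 * n + 1 dvd i + d i - j \<or> 2 * n + 1 dvd i + d i + j"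
      by (metis dvd_0_right)
  next
    fix j assume j: "j \<in> {1..n}"
    \<comment> \<open>Up to sign modulo 2n + 1, every j in 1, ..., n is some 2x with x in 1, ..., n:
      take x = j/2 or x = (2n + 1 - j)/2. So only targets of the form 2x need to be reached.\<close>
    have *: "\<exists>i\<in>{1..n}. 2 * i + d i - 2 * x = 0 \<or> 2 * i + d i + 2 * x = 2 * n + 1"
      if x: "x \<in> {1..n}" for x
    proof (cases "x < c \<or> c + m + L \<le> x")
      case True
      then have "d x = 0" using L Lm by (auto simp: d_def)
      then show ?thesis using x by (intro bexI[of _ x]) auto
    next
      case x': False
      show ?thesis
      \<comment> \<open>The first block supplies these x, since 2(2m - x) + L = 2n + 1 - 2x.\<close>
      proof (cases "c \<le> 2 * m - x \<and> 2 * m - x < c + m")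
        case True
        then have "d (2 * m - x) = L" by (auto simp: d_def)
        then show ?thesis using True n end_le c L by (intro bexI[of _ "2 * m - x"]) auto
      next
        case False
        show ?thesis
        proof (cases "even m")
          case True
          \<comment> \<open>For even \<open>m\<close> the reflection misses exactly c, ..., c + L -
            1. Adding \<open>m\<close> leads into the second block, and 2(x + m) - D = 2x because D
            = 2m.\<close>
          then have "x < c + L" using x' False mc by linarith
          then have "d (x + m) = - D" using x' L Lm by (auto simp: d_def)
          then show ?thesis using x' True \<open>x < c + L\<close> end_le mc c Lm L
            by (intro bexI[of _ "x + m"]) (auto simp: D_def)
        next
          case odd: False
          \<comment> \<open>For odd \<open>m\<close> the reflection preserves the first block, so x
            is in the second one, which 3m + L - x reverses. With D = 2m + L, 2(3m + L - x) - D = 2n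
            + 1 - 2x.\<close>
          then have "c + m \<le> 3 * m + L - x \<and> 3 * m + L - x < c + m + L"
            using x' False mc L by auto
          moreover from this have "d (3 * m + L - x) = - D" using L Lm by (auto simp: d_def)
          ultimately show ?thesis using odd end_le mc c Lm L n
            by (intro bexI[of _ "3 * m + L - x"]) (auto simp: D_def)
        qed
      qed
    qed
    show "\<exists>i\<in>{1..n}. 2 * n + 1 dvd 2 * i + d i - j \<or> 2 * n + 1 dvd 2 * i + d i + j"
    proof (cases "even j")
      case True
      then obtain x where x: "j = 2 * x" by blast
      then obtain i where "i \<in> {1..n}"
        "2 * i + d i - j = 0 \<or> 2 * i + d i + j = 2 * n + 1" using *[of x] j by auto
      then show ?thesis by (metis dvd_0_right dvd_refl)
    next
      case False
      then obtain x where x: "2 * n + 1 - j = 2 * x"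
        by (metis even_diff even_plus_one_iff dvd_triv_left evenE odd_add)
      then obtain i where "i \<in> {1..n}"
        "2 * i + d i + j = 2 * n + 1 \<or> 2 * i + d i - j = 0"
        using *[of x] j by fastforce
      then show ?thesis by (metis dvd_0_right dvd_refl)
    qed
  next
    fix s :: "'a \<Rightarrow> 'a" and h :: 'a
    assume s: "\<And>x. s (- x) = - s x" "s 0 = 0"
      "\<And>i. i \<in> {1..n} \<Longrightarrow> s (of_int i) = of_int (d i)"
      "\<And>x. s (h * x) = h * s x" and h: "h \<noteq> 0"
    define l :: 'a where "l = of_int L"
    define e :: 'a where "e = of_int D"
    have vals: "s x \<in> {0, l, - l, e, - e}" for x
    proof -
      obtain j where j: "0 \<le> j" "j \<le> n" "x = of_int j \<or> x = - of_int j" using rep .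
      have "s (of_int j) \<in> {0, l, - e}"
      proof (cases "j = 0")
        case True
        then show ?thesis using s(2) by simp
      next
        case False
        then have "s (of_int j) = of_int (d j)" using j s(3)[of j] by simp
        then show ?thesis by (auto simp: d_def l_def e_def)
      qed
      then show ?thesis using j(3) s(1) by fastforce
    qed
    have "s (of_int c) = l" using s(3)[of c] end_le c L Lm by (auto simp: d_def l_def)
    then have hl: "h * l \<in> {0, l, - l, e, - e}" using s(4)[of "of_int c"] vals by metis
    have "s (of_int (c + m)) = - e"
      using s(3)[of "c + m"] end_le c L Lm by (auto simp: d_def e_def)
    then have "- (h * e) \<in> {0, l, - l, e, - e}"
      using s(4)[of "of_int (c + m)"] vals by (metis mult_minus_right)
    then have he: "h * e \<in> {0, l, - l, e, - e}" by (auto simp: minus_equation_iff)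
    have small: "of_int i \<noteq> (0::'a)" if "0 < i" "i < 2 * n + 1" for i
      using of_int_eq_0_iff[of i] zdvd_imp_le[of "2 * n + 1" i] that by auto
    have l0: "l \<noteq> 0" unfolding l_def using L Lm n by (intro small) auto
    \<comment> \<open>From \<open>L < m\<close> follows m > 1, so the modulus 4m + L exceeds
      5.\<close>
    have "of_int 5 \<noteq> (0::'a)" using L Lm n by (intro small) auto
    then have five: "(5::'a) \<noteq> 0" by simp
    have "(of_int (2 * n + 1) :: 'a) = 0" using of_int_eq_0_iff dvd_refl by (rule iffD2)
    moreover have "2 * D + L = 2 * n + 1 \<or> 2 * D - L = 2 * n + 1"
      using n mc by (auto simp: D_def)
    ultimately have "(of_int (2 * D + L) :: 'a) = 0 \<or> (of_int (2 * D - L) :: 'a) = 0"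
      by metis
    then have "2 * e = - l \<or> 2 * e = l" by (auto simp: l_def e_def eq_neg_iff_add_eq_0)
    then have "(2 * e)\<^sup>2 = l\<^sup>2" by (simp only: power2_eq_iff) blast
    then have el: "l\<^sup>2 = 4 * e\<^sup>2" by (simp add: power_mult_distrib)
    have e0: "e \<noteq> 0" using el l0 by auto
    show "h\<^sup>2 = 1"
    proof (rule ccontr)
      assume h2: "h\<^sup>2 \<noteq> 1"
      \<comment> \<open>Multiplication by \<open>h\<close> sends no nonzero y to 0, y or -y. Among
        the possible values of s, this forces \<open>h * l\<close> to be e or -e and
        \<open>h * e\<close> to be l or -l.\<close>
      have neq: "h * y \<noteq> 0" "h * y \<noteq> y" "h * y \<noteq> - y" if "y \<noteq> 0" for y
        using h h2 that mult_cancel_right[of h y "- 1"] by (auto simp: power2_eq_1_iff)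
      have "(h * l)\<^sup>2 = e\<^sup>2" "(h * e)\<^sup>2 = l\<^sup>2"
        using hl he neq[OF l0] neq[OF e0] unfolding power2_eq_iff by blast+
      then have 1: "h\<^sup>2 * l\<^sup>2 = e\<^sup>2" "h\<^sup>2 * e\<^sup>2 = l\<^sup>2" by (simp_all add: power_mult_distrib)
      \<comment> \<open>Composing both relations gives h^4 = 1, hence h^2 = -1. Then -e^2 = l^2 = 4
        e^2, so 5 e^2 = 0.\<close>
      then have "(h\<^sup>2)\<^sup>2 * e\<^sup>2 = e\<^sup>2" by (simp add: power2_eq_square mult.assoc)
      then have "(h\<^sup>2)\<^sup>2 = 1" using e0 by simp
      then have "h\<^sup>2 = - 1" using h2 power2_eq_1_iff[of "h\<^sup>2"] by blast
      then have "4 * e\<^sup>2 + e\<^sup>2 = 0" using 1(2) el by simp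
      then have "5 * e\<^sup>2 = 0" by (simp add: algebra_simps)
      then show False using five e0 by simp
    qed
  qed
qed

section \<open>The fields of order 3 and 11\<close>

text \<open>The only nonzero elements are 1 and -1, so every nonzero \<open>h\<close> has square 1
  and the map 2x itself works.\<close>

lemma exists_order_3:
  assumes g: "mult_generator (g :: 'a)" and odd_card: "odd CARD('a)" and two: "(2::'a) \<noteq> 0"
    and n: "n = 1"
  shows "\<exists>\<phi>. \<phi> \<in> least_index_orthomorphisms g ((CARD('a) - 1) div 2)"
proof (rule exists_least_index[OF g odd_card two, of "\<lambda>i. 0"])
  fix h :: 'a assume h: "h \<noteq> 0"
  obtain j where j: "0 \<le> j" "j \<le> n" "h = of_int j \<or> h = - of_int j" using rep .
  then have "j = 0 \<or> j = 1" using n by auto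
  then show "h\<^sup>2 = 1" using j(3) h by auto
qed (use n in auto)

text \<open>As 11 = 4 * 2 + 3, the bound \<open>L < m\<close> of \<open>block_swap\<close> fails.
  Commuting with \<open>h\<close> carries zeros of s to zeros, so the zero 1 goes to
  \<open>h\<close>, which must then be 1 or -1.\<close>

lemma exists_order_11:
  assumes g: "mult_generator (g :: 'a)" and odd_card: "odd CARD('a)" and two: "(2::'a) \<noteq> 0"
    and n: "n = 5"
  shows "\<exists>\<phi>. \<phi> \<in> least_index_orthomorphisms g ((CARD('a) - 1) div 2)"
proof -
  \<comment> \<open>For i = 1, ..., 5, up to sign modulo 11, \<open>i + d i\<close> runs through 1,
    3, 4, 5, 2 and \<open>2 * i + d i\<close> through 2, 5, 4, 1, 3.\<close>
  define d :: "int \<Rightarrow> int" where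
    "d i = (if i = 1 then 0 else if i = 2 \<or> i = 3 then 1 else if i = 4 then 2 else 4)" for i
  have 5: "{1..5::int} = {1, 2, 3, 4, 5}" by auto
  show ?thesis
  proof (rule exists_least_index[OF g odd_card two, of d])
    fix s :: "'a \<Rightarrow> 'a" and h :: 'a
    assume s: "\<And>x. s (- x) = - s x" "s 0 = 0"
      "\<And>i. i \<in> {1..n} \<Longrightarrow> s (of_int i) = of_int (d i)"
      "\<And>x. s (h * x) = h * s x" and h: "h \<noteq> 0"
    obtain j where j: "0 \<le> j" "j \<le> n" "h = of_int j \<or> h = - of_int j" using rep .
    have "s 1 = 0" using s(3)[of 1] n by (simp add: d_def)
    then have "s h = 0" using s(4)[of 1] by simp
    then have "s (of_int j) = 0" using j(3) s(1) by auto
    moreover have "j \<noteq> 0" using j(3) h by auto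
    ultimately have "(of_int (d j) :: 'a) = 0" using s(3)[of j] j by simp
    then have "11 dvd d j" unfolding of_int_eq_0_iff n by simp
    then have "j = 1" using zdvd_imp_le[of 11 "d j"] by (auto simp: d_def split: if_splits)
    then show "h\<^sup>2 = 1" using j(3) by auto
  qed (auto simp: n 5 d_def)
qed

end

section \<open>Case distinction on the field\<close>

theorem theorem3p3:
  fixes g :: "'a::{field,finite}" and q :: nat
  assumes "primepow q" and "odd q" and "q \<notin> {5, 7}"
    and "CARD('a) = q"
    and "mult_generator g"
  shows "\<exists>\<phi>. \<phi> \<in> least_index_orthomorphisms g ((q - 1) div 2)"
proof -
  have p: "prime CHAR('a)" by (intro prime_CHAR_semidom finite_imp_CHAR_pos) simp
  have dvd: "CHAR('a) dvd q" using CHAR_dvd_CARD[where ?'a = 'a] assms(4) by simp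
  then have odd_p: "odd CHAR('a)" using assms(2) by auto
  have "\<not> CHAR('a) dvd 2"
    using p odd_p by (metis primes_dvd_imp_eq two_is_prime_nat even_iff_mod_2_eq_zero mod_self)
  then have two: "(2::'a) \<noteq> 0" using of_nat_eq_0_iff_char_dvd[of 2, where ?'a = 'a] by simp
  show ?thesis
  proof (cases "range of_int = (UNIV :: 'a set)")
    case False
    then obtain c :: 'a where "c \<notin> range of_int" by blast
    then show ?thesis using exists_of_proper_prime_field[OF assms(5) _ two odd_p] assms(2,4) by simp
  next
    case True
    \<comment> \<open>Residues modulo p exhaust the field, so q is at most p; since p divides q,
      they are equal.\<close>
    have "UNIV \<subseteq> (of_int :: int \<Rightarrow> 'a) ` {0..<int CHAR('a)}"
    proof
      fix x :: 'a
      obtain i where i: "x = of_int i" using True by (metis UNIV_I imageE)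
      then have "x = of_int (i mod int CHAR('a))"
        unfolding i of_int_eq_iff_cong_CHAR by (simp add: cong_def)
      then show "x \<in> of_int ` {0..<int CHAR('a)}"
        using p prime_gt_0_nat by fastforce
    qed
    then have "CARD('a) \<le> card {0..<int CHAR('a)}" by (rule surj_card_le[rotated]) simp
    then have "q \<le> CHAR('a)" using assms(4) by simp
    moreover have "CHAR('a) \<le> q" using dvd assms(2) by (intro dvd_imp_le) (auto intro: Nat.gr0I)
    ultimately have q: "CHAR('a) = q" by simp
    obtain t where t: "q = 2 * t + 1" using assms(2) oddE by blast
    interpret odd_prime_field "int t" "TYPE('a)"
      by standard (simp add: q t, rule True)
    have oddc: "odd CARD('a)" using assms(2,4) by simp
    have prime: "prime q" using p q by simp
    note blk = block_swap[OF assms(5) oddc two]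
    \<comment> \<open>\<open>L\<close> is the residue of q modulo 4. The bound \<open>L < m\<close>
      fails only for q = 1, 5 when L = 1 and for q = 3, 7, 11, 15 when L = 3; of these, 1 and 15 are
      not prime.\<close>
    have "q = 3 \<or> q = 11 \<or> (\<exists>L m. (L = 1 \<or> L = 3) \<and> L < m \<and> q = 4 * m + L)"
    proof -
      have "q \<noteq> 9" "q \<noteq> 15" "q \<noteq> 1" using prime prime_nat_not_dvd[of q 3] by auto
      moreover have "q \<noteq> 5" "q \<noteq> 7" using assms(3) by auto
      ultimately show ?thesis using assms(2) by presburger
    qed
    then consider "q = 3" | "q = 11" | L m where "L = 1 \<or> L = 3" "L < m" "q = 4 * m + L"
      by blast
    then have "\<exists>\<phi>. \<phi> \<in> least_index_orthomorphisms g ((CARD('a) - 1) div 2)"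
    proof cases
      case 1
      then show ?thesis using exists_order_3[OF assms(5) oddc two] t by simp
    next
      case 2
      then show ?thesis using exists_order_11[OF assms(5) oddc two] t by simp
    next
      case (3 L m)
      have n: "2 * int t + 1 = 4 * int m + int L" using t 3 by simp
      show ?thesis
      proof (cases "even m")
        case True
        then have c: "2 * ((int m - int L + 1) div 2) = int m - int L + 1" using 3(1) by auto
        show ?thesis
          by (rule blk[OF n, where c = "(int m - int L + 1) div 2"]) (use 3 c True in auto)
      next
        case False
        then have "even (int m + 1)" by simp
        then have c: "2 * ((int m + 1) div 2) = int m + 1" by (rule dvd_mult_div_cancel)
        show ?thesis
          by (rule blk[OF n, where c = "(int m + 1) div 2"]) (use 3 c False in auto)
      qed
    qed
    then show ?thesis using assms(4) by simp
  qed
qed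

end
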